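(* For each cardinal $\nu<\kappa$, the $(\mathrm{cf}(\kappa),\kappa,\nu)$-distributive law fails for $\mathbb{P}$ (i.e. for its regular open completion).
   Context: $\kappa$ is a singular cardinal (of arbitrary cofinality) and $\langle \kappa_\alpha:\alpha<\mathrm{cf}(\kappa)\rangle$ is a strictly increasing sequence of regular cardinals with supremum $\kappa$ such that $\mathrm{cf}(\kappa)<\kappa_\alpha<\kappa$ for all $\alpha$. Standing assumption: $\mu^{\mathrm{cf}(\kappa)}<\kappa$ for every cardinal $\mu<\kappa$. Let $N$ be the set of functions $t$ with $\mathrm{dom}(t)$ an ordinal $<\mathrm{cf}(\kappa)$ and $t(\alpha)<\kappa_\alpha$ for all $\alpha\in\mathrm{dom}(t)$, and $X$ the set of functions $f$ with domain $\mathrm{cf}(\kappa)$ and $f(\alpha)<\kappa_\alpha$. A tree is a subset $T\subseteq N$ closed under initial segments; $[T]=\{f\in X: f\restriction\alpha\in T\ \forall\alpha<\mathrm{cf}(\kappa)\}$; $\mathrm{Succ}_T(t)$ is the set of one-point extensions of $t$ in $T$. $T$ is suitable if it is nonempty, every $t\in T$ has an extension in $[T]$, and every maximal element of $T\cup[T]$ under extension lies in $[T]$. $T$ is perfect if it is suitable and for every $\alpha<\mathrm{cf}(\kappa)$ and $t\in T$ there is $t'\in T$ extending $t$ with $|\mathrm{Succ}_T(t')|\ge\kappa_\alpha$. $\mathbb{P}$ is the set of perfect trees ordered by inclusion. The $(\lambda,\mu,\nu)$-distributive law means the $(\lambda,\mu,<\nu^+)$-distributive law: for every family $\{A_\alpha:\alpha<\lambda\}$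 of maximal antichains of size $\le\mu$ in the completion, there are $Y_\alpha\subseteq A_\alpha$ with $|Y_\alpha|\le\nu$ and a nonzero element below $\bigvee Y_\alpha$ for every $\alpha<\lambda$. *)

theory Defs
  imports "HOL-Analysis.Abstract_Topology" "HOL-Library.Disjoint_Sets"
begin

unbundle cardinal_syntax

section \<open>Cardinals\<close>

text \<open>
  Cardinals are the initial ordinals \<^const>\<open>Card_order\<close> of the BNF cardinal library. An ordinal
  below a cardinal \<open>r\<close> is an element of \<^term>\<open>Field r\<close>; its set of predecessors is
  \<^term>\<open>underS r a\<close>.
\<close>

definition regular_cardinal :: "'a rel \<Rightarrow> bool" where
  "regular_cardinal r \<longleftrightarrow> Cinfinite r \<and> regularCard r"

definition singular_cardinal :: "'a rel \<Rightarrow> bool" where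
  "singular_cardinal r \<longleftrightarrow> Cinfinite r \<and> \<not> regularCard r"

definition is_cofinality :: "'c rel \<Rightarrow> 'a rel \<Rightarrow> bool" where
  "is_cofinality c r \<longleftrightarrow> Card_order c \<and>
     (\<exists>A \<subseteq> Field r. cofinal A r \<and> |A| =o c) \<and>
     (\<forall>A \<subseteq> Field r. cofinal A r \<longrightarrow> c \<le>o |A| )"

text \<open>
  In the supremum condition it suffices to let \<open>\<mu>\<close> range over cardinals on the type of \<open>\<kappa>\<close>:
  every cardinal smaller than \<open>\<kappa>\<close> has a copy there.
\<close>

definition regular_sequence_with_sup :: "'c rel \<Rightarrow> ('c \<Rightarrow> 'a rel) \<Rightarrow> 'a rel \<Rightarrow> bool" where
  "regular_sequence_with_sup c K \<kappa> \<longleftrightarrow>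
     (\<forall>\<alpha>\<in>Field c. regular_cardinal (K \<alpha>) \<and> c <o K \<alpha> \<and> K \<alpha> <o \<kappa>) \<and>
     (\<forall>\<beta>\<in>Field c. \<forall>\<alpha>\<in>underS c \<beta>. K \<alpha> <o K \<beta>) \<and>
     (\<forall>\<mu> :: 'a rel. Card_order \<mu> \<longrightarrow> (\<forall>\<alpha>\<in>Field c. K \<alpha> \<le>o \<mu>) \<longrightarrow> \<kappa> \<le>o \<mu>)"


section \<open>Perfect trees\<close>

text \<open>
  Functions with domain an ordinal are partial functions (maps): extension is \<open>\<subseteq>\<^sub>m\<close>, and the
  restriction of \<open>f\<close> to the ordinal \<open>\<alpha>\<close> is \<^term>\<open>f |` underS c \<alpha>\<close>. The cardinal \<open>c\<close> plays the role
  of \<open>cf(\<kappa>)\<close>, and \<open>K \<alpha>\<close> that of \<open>\<kappa>\<^sub>\<alpha>\<close>.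
\<close>

definition nodes :: "'c rel \<Rightarrow> ('c \<Rightarrow> 'a rel) \<Rightarrow> ('c \<rightharpoonup> 'a) set" where
  "nodes c K = {t. (\<exists>\<delta>\<in>Field c. dom t = underS c \<delta>) \<and>
                   (\<forall>\<alpha>\<in>dom t. the (t \<alpha>) \<in> Field (K \<alpha>))}"

definition full_functions :: "'c rel \<Rightarrow> ('c \<Rightarrow> 'a rel) \<Rightarrow> ('c \<rightharpoonup> 'a) set" where
  "full_functions c K = {f. dom f = Field c \<and> (\<forall>\<alpha>\<in>dom f. the (f \<alpha>) \<in> Field (K \<alpha>))}"

definition is_tree :: "'c rel \<Rightarrow> ('c \<Rightarrow> 'a rel) \<Rightarrow> ('c \<rightharpoonup> 'a) set \<Rightarrow> bool" where
  "is_tree c K T \<longleftrightarrow> T \<subseteq> nodes c K \<and> (\<forall>t\<in>T. \<forall>s\<in>nodes c K. s \<subseteq>\<^sub>m t \<longrightarrow> s \<in> T)"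

definition branches :: "'c rel \<Rightarrow> ('c \<Rightarrow> 'a rel) \<Rightarrow> ('c \<rightharpoonup> 'a) set \<Rightarrow> ('c \<rightharpoonup> 'a) set" where
  "branches c K T = {f \<in> full_functions c K. \<forall>\<alpha>\<in>Field c. f |` underS c \<alpha> \<in> T}"

definition Succ_in :: "'c rel \<Rightarrow> ('c \<rightharpoonup> 'a) set \<Rightarrow> ('c \<rightharpoonup> 'a) \<Rightarrow> ('c \<rightharpoonup> 'a) set" where
  "Succ_in c T t = {s \<in> T. \<exists>\<delta>\<in>Field c. \<exists>x. dom t = underS c \<delta> \<and> s = t(\<delta> \<mapsto> x)}"

definition suitable :: "'c rel \<Rightarrow> ('c \<Rightarrow> 'a rel) \<Rightarrow> ('c \<rightharpoonup> 'a) set \<Rightarrow> bool" where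
  "suitable c K T \<longleftrightarrow> is_tree c K T \<and> T \<noteq> {} \<and>
     (\<forall>t\<in>T. \<exists>f\<in>branches c K T. t \<subseteq>\<^sub>m f) \<and>
     (\<forall>m \<in> T \<union> branches c K T.
        (\<forall>s \<in> T \<union> branches c K T. m \<subseteq>\<^sub>m s \<longrightarrow> s = m) \<longrightarrow> m \<in> branches c K T)"

definition perfect_tree :: "'c rel \<Rightarrow> ('c \<Rightarrow> 'a rel) \<Rightarrow> ('c \<rightharpoonup> 'a) set \<Rightarrow> bool" where
  "perfect_tree c K T \<longleftrightarrow> suitable c K T \<and>
     (\<forall>\<alpha>\<in>Field c. \<forall>t\<in>T. \<exists>t'\<in>T. t \<subseteq>\<^sub>m t' \<and> K \<alpha> \<le>o |Succ_in c T t'| )"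


section \<open>The regular open completion of a partial order\<close>

text \<open>The open sets are the downward closed subsets of \<open>P\<close>: smaller conditions are stronger.\<close>

definition down_topology :: "'p set \<Rightarrow> ('p \<Rightarrow> 'p \<Rightarrow> bool) \<Rightarrow> 'p topology" where
  "down_topology P le = topology (\<lambda>U. U \<subseteq> P \<and> (\<forall>p\<in>U. \<forall>q\<in>P. le q p \<longrightarrow> q \<in> U))"

lemma openin_down_topology:
  "openin (down_topology P le) U \<longleftrightarrow> U \<subseteq> P \<and> (\<forall>p\<in>U. \<forall>q\<in>P. le q p \<longrightarrow> q \<in> U)"
proof -
  have "istopology (\<lambda>U. U \<subseteq> P \<and> (\<forall>p\<in>U. \<forall>q\<in>P. le q p \<longrightarrow> q \<in> U))"
    unfolding istopology_def by blast
  then show ?thesis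
    unfolding down_topology_def by (simp add: topology_inverse')
qed

text \<open>
  The regular open sets, ordered by inclusion, form a complete Boolean algebra with zero \<open>{}\<close>, meet
  \<open>\<inter>\<close>, and joins given by \<open>ro_join\<close>.
\<close>

definition regular_opens :: "'p topology \<Rightarrow> 'p set set" where
  "regular_opens X = {U. X interior_of (X closure_of U) = U}"

definition ro_join :: "'p topology \<Rightarrow> 'p set set \<Rightarrow> 'p set" where
  "ro_join X \<U> = X interior_of (X closure_of \<Union>\<U>)"

lemma ro_join_in_regular_opens: "ro_join X \<U> \<in> regular_opens X"
proof -
  let ?J = "X interior_of (X closure_of \<Union>\<U>)"
  have "X closure_of ?J \<subseteq> X closure_of \<Union>\<U>"
    by (simp add: closure_of_minimal interior_of_subset)
  then have "X interior_of (X closure_of ?J) \<subseteq> ?J"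
    by (rule interior_of_mono)
  moreover have "?J \<subseteq> X interior_of (X closure_of ?J)"
    by (simp add: closure_of_subset interior_of_maximal interior_of_subset_topspace)
  ultimately show ?thesis
    unfolding regular_opens_def ro_join_def by blast
qed

lemma ro_join_upper:
  assumes "\<U> \<subseteq> regular_opens X" and "U \<in> \<U>"
  shows "U \<subseteq> ro_join X \<U>"
proof -
  have "U = X interior_of (X closure_of U)"
    using assms unfolding regular_opens_def by auto
  also have "\<dots> \<subseteq> X interior_of (X closure_of \<Union>\<U>)"
    using assms(2) by (intro interior_of_mono closure_of_mono) blast
  finally show ?thesis unfolding ro_join_def .
qed

lemma ro_join_least:
  assumes "V \<in> regular_opens X" and "\<And>U. U \<in> \<U> \<Longrightarrow> U \<subseteq> V"
  shows "ro_join X \<U> \<subseteq> V"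
proof -
  have "ro_join X \<U> \<subseteq> X interior_of (X closure_of V)"
    unfolding ro_join_def using assms(2) by (intro interior_of_mono closure_of_mono) blast
  then show ?thesis using assms(1) unfolding regular_opens_def by simp
qed

definition ro_maximal_antichain :: "'p topology \<Rightarrow> 'p set set \<Rightarrow> bool" where
  "ro_maximal_antichain X A \<longleftrightarrow>
     A \<subseteq> regular_opens X - {{}} \<and> disjoint A \<and>
     (\<forall>V \<in> regular_opens X - {{}}. \<exists>U\<in>A. U \<inter> V \<noteq> {})"

text \<open>
  The \<open>(\<lambda>, \<mu>, \<nu>)\<close>-distributive law for the completion, with \<open>l\<close> for \<open>\<lambda>\<close>. Note that the nonzero
  element \<open>b\<close> is the same for all \<open>\<alpha>\<close>.
\<close>

definition ro_distributive ::
  "'p topology \<Rightarrow> 'l rel \<Rightarrow> 'm rel \<Rightarrow> 'n rel \<Rightarrow> bool" where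
  "ro_distributive X l \<mu> \<nu> \<longleftrightarrow>
     (\<forall>A :: 'l \<Rightarrow> 'p set set.
        (\<forall>\<alpha>\<in>Field l. ro_maximal_antichain X (A \<alpha>) \<and> |A \<alpha>| \<le>o \<mu>) \<longrightarrow>
        (\<exists>Y. (\<forall>\<alpha>\<in>Field l. Y \<alpha> \<subseteq> A \<alpha> \<and> |Y \<alpha>| \<le>o \<nu>) \<and>
             (\<exists>b \<in> regular_opens X - {{}}. \<forall>\<alpha>\<in>Field l. b \<subseteq> ro_join X (Y \<alpha>))))"

definition distributive_law ::
  "'p set \<Rightarrow> ('p \<Rightarrow> 'p \<Rightarrow> bool) \<Rightarrow> 'l rel \<Rightarrow> 'm rel \<Rightarrow> 'n rel \<Rightarrow> bool" where
  "distributive_law P le l \<mu> \<nu> \<longleftrightarrow> ro_distributive (down_topology P le) l \<mu> \<nu>"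

end

theory Submission
  imports Defs
begin

text \<open>
  The antichain \<open>A\<^sub>\<delta>\<close> decides the restriction of the generic branch to \<open>\<delta>\<close>: it consists of the
  regular open sets \<open>U\<^sub>t\<close> of perfect trees all of whose nodes are comparable with \<open>t\<close>, for the nodes
  \<open>t\<close> with domain \<open>\<delta>\<close>. It has at most \<open>\<kappa>\<^sub>\<delta>\<close> to the power \<open>cf(\<kappa>)\<close> many elements. If a perfect tree
  \<open>T\<close> lies below the join of \<open>Y\<^sub>\<delta> \<subseteq> A\<^sub>\<delta>\<close>, then \<open>U\<^sub>t \<in> Y\<^sub>\<delta>\<close> for every node \<open>t \<in> T\<close> with domain \<open>\<delta>\<close>. Hence
  if all \<open>Y\<^sub>\<delta>\<close> have size at most \<open>\<nu>\<close>, no node of \<open>T\<close> has more than \<open>\<nu>\<close> successors, whereas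
  perfectness gives a node with at least \<open>\<kappa>\<^sub>\<alpha> > \<nu>\<close> of them.
\<close>

section \<open>Comparability of nodes\<close>

definition comparable :: "('c \<rightharpoonup> 'a) \<Rightarrow> ('c \<rightharpoonup> 'a) \<Rightarrow> bool" where
  "comparable s t \<longleftrightarrow> s \<subseteq>\<^sub>m t \<or> t \<subseteq>\<^sub>m s"

definition nodes_at :: "'c rel \<Rightarrow> ('c \<Rightarrow> 'a rel) \<Rightarrow> 'c \<Rightarrow> ('c \<rightharpoonup> 'a) set" where
  "nodes_at c K \<delta> = {t \<in> nodes c K. dom t = underS c \<delta>}"

text \<open>Besides the extensions of \<open>t\<close> this keeps its initial segments, so that the
  result is closed under initial segments and can again be a tree.\<close>

definition subtree_at :: "('c \<rightharpoonup> 'a) set \<Rightarrow> ('c \<rightharpoonup> 'a) \<Rightarrow> ('c \<rightharpoonup> 'a) set" where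
  "subtree_at T t = {s \<in> T. comparable s t}"

text \<open>For a node \<open>t\<close> and a well-order \<open>c\<close>, the condition on a
  perfect tree \<open>T\<close> says equivalently that every branch of \<open>T\<close> extends
  \<open>t\<close>.\<close>

definition trees_through :: "'c rel \<Rightarrow> ('c \<Rightarrow> 'a rel) \<Rightarrow> ('c \<rightharpoonup> 'a) \<Rightarrow> ('c \<rightharpoonup> 'a) set set" where
  "trees_through c K t = {T. perfect_tree c K T \<and> (\<forall>s\<in>T. comparable s t)}"

lemma map_le_of_common_extension:
  assumes "s \<subseteq>\<^sub>m f" "t \<subseteq>\<^sub>m f" "dom s \<subseteq> dom t"
  shows "s \<subseteq>\<^sub>m t"
  unfolding map_le_def
proof
  fix a assume a: "a \<in> dom s"
  then have "s a = f a" using assms(1) unfolding map_le_def by blast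
  moreover have "t a = f a" using assms(2,3) a unfolding map_le_def by blast
  ultimately show "s a = t a" by simp
qed

lemma map_le_antisym_dom:
  assumes "s \<subseteq>\<^sub>m t" "dom t \<subseteq> dom s"
  shows "s = t"
  using map_le_antisym[OF assms(1) map_le_of_common_extension[OF map_le_refl assms]] .

lemma comparable_same_dom:
  assumes "comparable s t" "dom s = dom t"
  shows "s = t"
  using assms map_le_antisym_dom[of s t] map_le_antisym_dom[of t s] unfolding comparable_def by auto

lemma comparable_map_le:
  assumes "comparable s t" "dom s \<subseteq> dom t"
  shows "s \<subseteq>\<^sub>m t"
  using assms map_le_antisym_dom[of t s] unfolding comparable_def by auto

lemma underS_comparable:
  assumes "Well_order c"
  shows "underS c a \<subseteq> underS c b \<or> underS c b \<subseteq> underS c a"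
proof -
  have "wo_rel c" using assms by (simp add: wo_rel_def)
  then show ?thesis
    by (meson wo_rel.ofilter_linord wo_rel.underS_ofilter)
qed

lemma underS_subset_Field: "underS c a \<subseteq> Field c"
  by (auto simp: underS_def Field_def)

lemma underS_inj:
  assumes "Well_order c" "a \<in> Field c" "b \<in> Field c" "underS c a = underS c b"
  shows "a = b"
proof (rule ccontr)
  assume "a \<noteq> b"
  then have "a \<in> underS c b \<or> b \<in> underS c a"
    using assms by (auto simp: well_order_on_def linear_order_on_def total_on_def underS_def)
  then show False using assms(4) by (auto simp: underS_def)
qed

lemma nodes_dom_comparable:
  assumes "Well_order c" "s \<in> nodes c K" "t \<in> nodes c K"
  shows "dom s \<subseteq> dom t \<or> dom t \<subseteq> dom s"
proof -
  obtain a b where "dom s = underS c a" "dom t = underS c b"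
    using assms(2,3) unfolding nodes_def by blast
  then show ?thesis using underS_comparable[OF assms(1), of a b] by simp
qed

text \<open>Domains of nodes are initial segments of a well-order, hence nested, and two
  restrictions of one map \<open>f\<close> agree on the smaller domain.\<close>

lemma comparable_of_common_extension:
  assumes "Well_order c" "s \<in> nodes c K" "t \<in> nodes c K" "s \<subseteq>\<^sub>m f" "t \<subseteq>\<^sub>m f"
  shows "comparable s t"
  using nodes_dom_comparable[OF assms(1-3)] map_le_of_common_extension[OF assms(4,5)]
    map_le_of_common_extension[OF assms(5,4)]
  unfolding comparable_def by blast

section \<open>Levels of a perfect tree\<close>

lemma perfect_tree_nodes:
  assumes "perfect_tree c K T" "t \<in> T"
  shows "t \<in> nodes c K"
  using assms unfolding perfect_tree_def suitable_def is_tree_def by auto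

lemma perfect_tree_branch:
  assumes "perfect_tree c K T" "t \<in> T"
  obtains f where "f \<in> branches c K T" "t \<subseteq>\<^sub>m f"
  using assms unfolding perfect_tree_def suitable_def by blast

lemma restrict_map_le: "f |` A \<subseteq>\<^sub>m f"
  by (auto simp: map_le_def restrict_map_def)

lemma dom_restrict_branch:
  assumes "f \<in> branches c K T"
  shows "dom (f |` underS c \<delta>) = underS c \<delta>"
  using assms underS_subset_Field[of c \<delta>] unfolding branches_def full_functions_def by auto

text \<open>A branch through \<open>t\<close> meets every level, so cut it at \<delta>. The level
  may lie below or above \<open>t\<close>, which is why only comparability is claimed.\<close>

lemma perfect_tree_level_above:
  assumes wo: "Well_order c" and T: "perfect_tree c K T" and t: "t \<in> T"
    and \<delta>: "\<delta> \<in> Field c"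
  obtains s where "s \<in> T" "s \<in> nodes_at c K \<delta>" "comparable s t"
proof -
  obtain f where f: "f \<in> branches c K T" "t \<subseteq>\<^sub>m f"
    using perfect_tree_branch[OF T t] .
  let ?s = "f |` underS c \<delta>"
  have s: "?s \<in> T" using f(1) \<delta> unfolding branches_def by auto
  show thesis
  proof
    show "?s \<in> T" by (fact s)
    show "?s \<in> nodes_at c K \<delta>"
      using perfect_tree_nodes[OF T s] dom_restrict_branch[OF f(1)] unfolding nodes_at_def by blast
    show "comparable ?s t"
      using comparable_of_common_extension[OF wo perfect_tree_nodes[OF T s]
          perfect_tree_nodes[OF T t] restrict_map_le f(2)] .
  qed
qed

lemma perfect_tree_nonempty: "perfect_tree c K T \<Longrightarrow> T \<noteq> {}"
  unfolding perfect_tree_def suitable_def by blast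

section \<open>The part of a perfect tree comparable with one of its nodes\<close>

lemma subtree_at_extend:
  assumes "t \<in> T" "s \<in> subtree_at T t"
  obtains r where "r \<in> T" "s \<subseteq>\<^sub>m r" "t \<subseteq>\<^sub>m r"
proof (cases "s \<subseteq>\<^sub>m t")
  case True
  then show ?thesis using that[OF assms(1)] by simp
next
  case False
  then show ?thesis
    using that[of s] assms(2) unfolding subtree_at_def comparable_def by simp
qed

lemma branches_subtree_at:
  assumes wo: "Well_order c" and T: "perfect_tree c K T" and t: "t \<in> T"
    and f: "f \<in> branches c K T" "t \<subseteq>\<^sub>m f"
  shows "f \<in> branches c K (subtree_at T t)"
proof -
  have "comparable (f |` underS c \<alpha>) t" if "\<alpha> \<in> Field c" for \<alpha>
  proof -
    have "f |` underS c \<alpha> \<in> T" using f(1) that unfolding branches_def by auto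
    then show ?thesis
      using comparable_of_common_extension[OF wo _ _ restrict_map_le f(2)]
        perfect_tree_nodes[OF T] t by blast
  qed
  then show ?thesis using f(1) unfolding branches_def subtree_at_def by auto
qed

text \<open>Every node of the subtree extends to a node of \<open>T\<close> above \<open>t\<close>,
  and above \<open>t\<close> the subtree agrees with \<open>T\<close>. So the branches through
  \<open>t\<close> and the large successor sets above \<open>t\<close> are inherited.\<close>

lemma perfect_subtree_at:
  assumes wo: "Well_order c" and T: "perfect_tree c K T" and t: "t \<in> T"
  shows "perfect_tree c K (subtree_at T t)"
proof -
  let ?S = "subtree_at T t"
  have tree: "is_tree c K ?S"
    unfolding is_tree_def
  proof (intro conjI ballI impI)
    show "?S \<subseteq> nodes c K"
      using perfect_tree_nodes[OF T] unfolding subtree_at_def by auto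
    fix r s assume r: "r \<in> ?S" and s: "s \<in> nodes c K" "s \<subseteq>\<^sub>m r"
    have "s \<in> T"
      using T r s unfolding perfect_tree_def suitable_def is_tree_def subtree_at_def by blast
    moreover obtain u where u: "r \<subseteq>\<^sub>m u" "t \<subseteq>\<^sub>m u" using subtree_at_extend[OF t r] .
    have "comparable s t"
      using comparable_of_common_extension[OF wo s(1) perfect_tree_nodes[OF T t]
          map_le_trans[OF s(2) u(1)] u(2)] .
    ultimately show "s \<in> ?S" unfolding subtree_at_def by auto
  qed
  have branch: "\<exists>f\<in>branches c K ?S. s \<subseteq>\<^sub>m f" if s: "s \<in> ?S" for s
  proof -
    obtain r where r: "r \<in> T" "s \<subseteq>\<^sub>m r" "t \<subseteq>\<^sub>m r" using subtree_at_extend[OF t s] .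
    obtain f where f: "f \<in> branches c K T" "r \<subseteq>\<^sub>m f" using perfect_tree_branch[OF T r(1)] .
    then show ?thesis using branches_subtree_at[OF wo T t f(1)] r map_le_trans by metis
  qed
  have "t \<in> ?S" using t unfolding subtree_at_def comparable_def by simp
  \<comment> \<open>The clause on maximal elements follows from \<open>branch\<close>: a maximal
    node equals any branch that extends it.\<close>
  then have suit: "suitable c K ?S"
    unfolding suitable_def using tree branch by fast
  have "\<exists>t'\<in>?S. s \<subseteq>\<^sub>m t' \<and> K \<alpha> \<le>o |Succ_in c ?S t'|"
    if \<alpha>: "\<alpha> \<in> Field c" and s: "s \<in> ?S" for \<alpha> s
  proof -
    obtain r where r: "r \<in> T" "s \<subseteq>\<^sub>m r" "t \<subseteq>\<^sub>m r" using subtree_at_extend[OF t s] .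
    obtain t' where t': "t' \<in> T" "r \<subseteq>\<^sub>m t'" "K \<alpha> \<le>o |Succ_in c T t'|"
      using T \<alpha> r(1) unfolding perfect_tree_def by blast
    have le: "t \<subseteq>\<^sub>m t'" "s \<subseteq>\<^sub>m t'" using r t' map_le_trans by blast+
    have "t \<subseteq>\<^sub>m u" if u: "u \<in> Succ_in c T t'" for u
    proof -
      obtain \<delta> x where "dom t' = underS c \<delta>" "u = t'(\<delta> \<mapsto> x)"
        using u unfolding Succ_in_def by blast
      then have "t' \<subseteq>\<^sub>m u" by (auto simp: map_le_def underS_def)
      then show ?thesis using le(1) map_le_trans by blast
    qed
    then have "Succ_in c ?S t' = Succ_in c T t'"
      unfolding Succ_in_def subtree_at_def comparable_def by blast
    then show ?thesis using t' le unfolding subtree_at_def comparable_def by auto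
  qed
  then show ?thesis using suit unfolding perfect_tree_def by blast
qed

lemma subtree_at_in_trees_through:
  assumes "Well_order c" "perfect_tree c K T" "t \<in> T"
  shows "subtree_at T t \<in> trees_through c K t"
  using perfect_subtree_at[OF assms] unfolding trees_through_def subtree_at_def by auto

text \<open>A common element \<open>T\<close> has a node at level \<delta>. It is comparable with
  both \<open>s\<close> and \<open>t\<close> and has the same domain, so it equals both. Thus
  distinct nodes of one level give disjoint sets.\<close>

lemma trees_through_inj:
  assumes wo: "Well_order c" and \<delta>: "\<delta> \<in> Field c"
    and st: "s \<in> nodes_at c K \<delta>" "t \<in> nodes_at c K \<delta>"
    and T: "T \<in> trees_through c K s" "T \<in> trees_through c K t"
  shows "s = t"
proof -
  have perf: "perfect_tree c K T" using T(1) unfolding trees_through_def by auto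
  obtain u where "u \<in> T" using perfect_tree_nonempty[OF perf] by auto
  then obtain r where r: "r \<in> T" "r \<in> nodes_at c K \<delta>"
    using perfect_tree_level_above[OF wo perf _ \<delta>] by blast
  then have "r = s" "r = t"
    using T st comparable_same_dom[of r] unfolding trees_through_def nodes_at_def by auto
  then show ?thesis by simp
qed

section \<open>Regular open sets of perfect trees\<close>

lemma in_closure_of_down_topology:
  assumes "\<And>p. p \<in> P \<Longrightarrow> le p p" "\<And>p q r. le p q \<Longrightarrow> le q r \<Longrightarrow> le p r"
  shows "p \<in> down_topology P le closure_of U \<longleftrightarrow> p \<in> P \<and> (\<exists>q\<in>P. le q p \<and> q \<in> U)"
proof -
  have top: "topspace (down_topology P le) = P"
    unfolding topspace_def openin_down_topology by auto
  show ?thesis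
  proof
    assume p: "p \<in> down_topology P le closure_of U"
    then have pP: "p \<in> P" using top by (auto simp: closure_of_def)
    \<comment> \<open>The conditions below \<open>p\<close> form the smallest open neighbourhood of
      \<open>p\<close>, so only this one has to be tested.\<close>
    have "openin (down_topology P le) {q \<in> P. le q p}" (is "openin _ ?D")
      unfolding openin_down_topology using assms(2) by blast
    moreover have "p \<in> ?D" using pP assms(1) by simp
    ultimately obtain q where "q \<in> U" "q \<in> ?D"
      using p[unfolded in_closure_of, THEN conjunct2, THEN spec, THEN mp, of ?D] by auto
    then show "p \<in> P \<and> (\<exists>q\<in>P. le q p \<and> q \<in> U)"
      using pP by auto
  next
    assume "p \<in> P \<and> (\<exists>q\<in>P. le q p \<and> q \<in> U)"
    then show "p \<in> down_topology P le closure_of U"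
      unfolding in_closure_of top openin_down_topology by (intro conjI) blast+
  qed
qed

abbreviation perfect_topology :: "'c rel \<Rightarrow> ('c \<Rightarrow> 'a rel) \<Rightarrow> ('c \<rightharpoonup> 'a) set topology" where
  "perfect_topology c K \<equiv> down_topology {T. perfect_tree c K T} (\<subseteq>)"

lemma in_closure_of_perfect_topology:
  "T \<in> perfect_topology c K closure_of U \<longleftrightarrow>
     perfect_tree c K T \<and> (\<exists>S. perfect_tree c K S \<and> S \<subseteq> T \<and> S \<in> U)"
  by (subst in_closure_of_down_topology) auto

lemma openin_perfect_topology_down:
  assumes "openin (perfect_topology c K) V" "T \<in> V" "perfect_tree c K S" "S \<subseteq> T"
  shows "S \<in> V"
  using assms unfolding openin_down_topology by blast

lemma openin_regular_open: "V \<in> regular_opens X \<Longrightarrow> openin X V"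
  using openin_interior_of[of X "X closure_of V"] unfolding regular_opens_def by simp

lemmas regular_open_down = openin_perfect_topology_down[OF openin_regular_open]

lemma regular_open_perfect:
  assumes "V \<in> regular_opens (perfect_topology c K)" "T \<in> V"
  shows "perfect_tree c K T"
  using openin_regular_open[OF assms(1)] assms(2) unfolding openin_down_topology by blast

text \<open>Suppose that some node \<open>s\<close> of \<open>T\<close> had to be compared with
  \<open>t\<close>. If \<open>T\<close> is in the interior of the closure, then
  \<open>subtree_at T s\<close> can be shrunk to a perfect tree in the set. A sufficiently high node
  of that tree extends both \<open>s\<close> and \<open>t\<close>, which makes them
  comparable.\<close>

lemma trees_through_regular_open:
  assumes wo: "Well_order c" and t: "t \<in> nodes c K"
  shows "trees_through c K t \<in> regular_opens (perfect_topology c K)"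
proof -
  let ?X = "perfect_topology c K" and ?U = "trees_through c K t"
  have "openin ?X ?U"
    unfolding openin_down_topology trees_through_def by blast
  then have "?U \<subseteq> ?X interior_of (?X closure_of ?U)"
    by (simp add: closure_of_subset interior_of_maximal openin_subset)
  moreover have "T \<in> ?U" if T: "T \<in> ?X interior_of (?X closure_of ?U)" for T
  proof -
    have perf: "perfect_tree c K T"
      using subsetD[OF interior_of_subset T] unfolding in_closure_of_perfect_topology by (rule conjunct1)
    have "comparable s t" if s: "s \<in> T" for s
    proof -
      have "subtree_at T s \<in> ?X interior_of (?X closure_of ?U)"
        using openin_perfect_topology_down[OF openin_interior_of T perfect_subtree_at[OF wo perf s]]
        by (simp add: subtree_at_def)
      then have "subtree_at T s \<in> ?X closure_of ?U"
        by (rule subsetD[OF interior_of_subset])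
      then obtain S where S: "perfect_tree c K S" "S \<subseteq> subtree_at T s" "S \<in> ?U"
        unfolding in_closure_of_perfect_topology by blast
      have sn: "s \<in> nodes c K" using perfect_tree_nodes[OF perf s] .
      \<comment> \<open>Take the larger of the two domains: a node of \<open>S\<close> at that
        level, being comparable with \<open>s\<close> and \<open>t\<close>, must extend
        both.\<close>
      obtain \<delta> where \<delta>: "\<delta> \<in> Field c" "dom s \<subseteq> underS c \<delta>" "dom t \<subseteq> underS c \<delta>"
      proof -
        obtain \<delta> \<delta>' where "\<delta> \<in> Field c" "\<delta>' \<in> Field c" "dom s = underS c \<delta>" "dom t = underS c \<delta>'"
          using sn t unfolding nodes_def by blast
        then show thesis using that nodes_dom_comparable[OF wo sn t] by auto
      qed
      obtain u where "u \<in> S" using perfect_tree_nonempty[OF S(1)] by auto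
      then obtain r where r: "r \<in> S" "r \<in> nodes_at c K \<delta>"
        using perfect_tree_level_above[OF wo S(1) _ \<delta>(1)] by blast
      have "comparable s r" "comparable t r"
        using r S unfolding subtree_at_def trees_through_def comparable_def by blast+
      then have "s \<subseteq>\<^sub>m r" "t \<subseteq>\<^sub>m r"
        using comparable_map_le \<delta> r(2) unfolding nodes_at_def by blast+
      then show ?thesis using comparable_of_common_extension[OF wo sn t] by blast
    qed
    then show ?thesis using perf unfolding trees_through_def by blast
  qed
  ultimately show ?thesis unfolding regular_opens_def by blast
qed

section \<open>The maximal antichain of a level and its size\<close>

text \<open>Subtracting \<open>{{}}\<close> makes every element nonzero without constructing a
  perfect tree through each node.\<close>

definition level_antichain :: "'c rel \<Rightarrow> ('c \<Rightarrow> 'a rel) \<Rightarrow> 'c \<Rightarrow> ('c \<rightharpoonup> 'a) set set set" where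
  "level_antichain c K \<delta> = trees_through c K ` nodes_at c K \<delta> - {{}}"

text \<open>Disjointness is \<open>trees_through_inj\<close>. For maximality, any tree
  \<open>T\<close> in \<open>V\<close> has a node \<open>t\<close> at level \<delta>, and
  \<open>subtree_at T t\<close> lies both in \<open>V\<close> and in the antichain element of
  \<open>t\<close>.\<close>

lemma level_antichain_maximal:
  assumes wo: "Well_order c" and \<delta>: "\<delta> \<in> Field c"
  shows "ro_maximal_antichain (perfect_topology c K) (level_antichain c K \<delta>)"
  unfolding ro_maximal_antichain_def
proof (intro conjI ballI)
  show "level_antichain c K \<delta> \<subseteq> regular_opens (perfect_topology c K) - {{}}"
    using trees_through_regular_open[OF wo] unfolding level_antichain_def nodes_at_def by blast
  show "disjoint (level_antichain c K \<delta>)"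
    using trees_through_inj[OF wo \<delta>] unfolding level_antichain_def disjoint_def by blast
next
  fix V assume V: "V \<in> regular_opens (perfect_topology c K) - {{}}"
  then obtain T where T: "T \<in> V" by blast
  have perf: "perfect_tree c K T" using regular_open_perfect V T by blast
  obtain u where "u \<in> T" using perfect_tree_nonempty[OF perf] by auto
  then obtain t where t: "t \<in> T" "t \<in> nodes_at c K \<delta>"
    using perfect_tree_level_above[OF wo perf _ \<delta>] by blast
  have "subtree_at T t \<in> V"
    using regular_open_down[OF _ T perfect_subtree_at[OF wo perf t(1)]] V
    unfolding subtree_at_def by blast
  then show "\<exists>U\<in>level_antichain c K \<delta>. U \<inter> V \<noteq> {}"
    using subtree_at_in_trees_through[OF wo perf t(1)] t(2) unfolding level_antichain_def by blast
qed

text \<open>Each factor \<open>Field (K \<beta>)\<close> with \<beta> below \<delta> injects into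
  \<open>Field (K \<delta>)\<close>, so a node of level \<delta> is coded by a function from
  \<open>Field c\<close> to \<open>Field (K \<delta>)\<close>.\<close>

lemma card_nodes_at:
  fixes c :: "'c rel" and K :: "'c \<Rightarrow> 'a rel"
  assumes inf: "\<not> finite (Field (K \<delta>))"
    and le: "\<And>\<beta>. \<beta> \<in> underS c \<delta> \<Longrightarrow> |Field (K \<beta>)| \<le>o |Field (K \<delta>)|"
  shows "|nodes_at c K \<delta>| \<le>o K \<delta> ^c c"
proof -
  have "\<exists>g. inj_on g (Field (K \<beta>)) \<and> g ` Field (K \<beta>) \<subseteq> Field (K \<delta>)" if "\<beta> \<in> underS c \<delta>" for \<beta>
    using le[OF that] card_of_ordLeq by blast
  then obtain g where g: "\<And>\<beta>. \<beta> \<in> underS c \<delta> \<Longrightarrow> inj_on (g \<beta>) (Field (K \<beta>))"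
      "\<And>\<beta>. \<beta> \<in> underS c \<delta> \<Longrightarrow> g \<beta> ` Field (K \<beta>) \<subseteq> Field (K \<delta>)"
    by metis
  obtain x0 where x0: "x0 \<in> Field (K \<delta>)" using inf by fastforce
  \<comment> \<open>The filler \<open>x0\<close> makes the code total on \<open>Field c\<close>, and
    \<open>undefined\<close> outside is what \<open>Func\<close> demands. Since all nodes of the
    level have the same domain, the padding loses no information.\<close>
  define F where "F t = (\<lambda>\<beta>. if \<beta> \<in> underS c \<delta> then g \<beta> (the (t \<beta>))
      else if \<beta> \<in> Field c then x0 else undefined)" for t :: "'c \<rightharpoonup> 'a"
  have val: "the (t \<beta>) \<in> Field (K \<beta>)" if "t \<in> nodes_at c K \<delta>" "\<beta> \<in> underS c \<delta>" for t \<beta>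
    using that unfolding nodes_at_def nodes_def by blast
  have "inj_on F (nodes_at c K \<delta>)"
  proof (rule inj_onI, rule ext)
    fix s t \<beta> assume s: "s \<in> nodes_at c K \<delta>" and t: "t \<in> nodes_at c K \<delta>" and eq: "F s = F t"
    have dom: "dom s = underS c \<delta>" "dom t = underS c \<delta>" using s t unfolding nodes_at_def by auto
    show "s \<beta> = t \<beta>"
    proof (cases "\<beta> \<in> underS c \<delta>")
      case True
      have "g \<beta> (the (s \<beta>)) = g \<beta> (the (t \<beta>))"
        using fun_cong[OF eq, of \<beta>] True unfolding F_def by simp
      then have "the (s \<beta>) = the (t \<beta>)"
        using g(1)[OF True] val[OF s True] val[OF t True] by (meson inj_onD)
      then show ?thesis using True dom by (metis domD option.sel)
    next
      case False
      then show ?thesis using dom by (metis domIff)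
    qed
  qed
  moreover have "F ` nodes_at c K \<delta> \<subseteq> Func (Field c) (Field (K \<delta>))"
  proof (rule image_subsetI)
    fix t assume t: "t \<in> nodes_at c K \<delta>"
    have "F t \<beta> \<in> Field (K \<delta>)" if "\<beta> \<in> Field c" for \<beta>
      using val[OF t] g(2)[of \<beta>] x0 that unfolding F_def by auto
    moreover have "F t \<beta> = undefined" if "\<beta> \<notin> Field c" for \<beta>
      using that underS_subset_Field[of c \<delta>] unfolding F_def by auto
    ultimately show "F t \<in> Func (Field c) (Field (K \<delta>))" unfolding Func_def by blast
  qed
  ultimately show ?thesis unfolding cexp_def using card_of_ordLeq by blast
qed

lemma regular_sequence_with_sup_above:
  fixes K :: "'c \<Rightarrow> 'a rel"
  assumes "regular_sequence_with_sup c K \<kappa>" and \<nu>: "Card_order \<nu>" "\<nu> <o \<kappa>"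
  shows "\<exists>\<alpha>\<in>Field c. \<nu> <o K \<alpha>"
proof (rule ccontr)
  assume none: "\<not> (\<exists>\<alpha>\<in>Field c. \<nu> <o K \<alpha>)"
  \<comment> \<open>The supremum condition ranges over cardinals on the type of \<kappa>, so \<nu>
    is first copied to that type.\<close>
  obtain \<mu> :: "'a rel" where \<mu>: "\<nu> =o \<mu>" "\<mu> <o \<kappa>"
    using internalize_ordLess[THEN iffD1, OF \<nu>(2)] by blast
  have "K \<alpha> \<le>o \<mu>" if "\<alpha> \<in> Field c" for \<alpha>
  proof -
    have "Card_order (K \<alpha>)"
      using assms(1) that unfolding regular_sequence_with_sup_def regular_cardinal_def by blast
    then have "K \<alpha> \<le>o \<nu>"
      using none that not_ordLess_iff_ordLeq[OF card_order_on_well_order_on card_order_on_well_order_on]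
        \<nu>(1) by metis
    then show ?thesis using \<mu>(1) by (rule ordLeq_ordIso_trans)
  qed
  moreover have "Card_order \<mu>" using Card_order_ordIso2[OF \<nu>(1) \<mu>(1)] .
  ultimately have "\<kappa> \<le>o \<mu>" using assms(1) unfolding regular_sequence_with_sup_def by blast
  then show False using not_ordLess_ordLeq[OF \<mu>(2)] by simp
qed

text \<open>The sequence increases, so \<open>K \<delta>\<close> dominates all earlier factors; the
  hypothesis on powers, applied to \<open>K \<delta>\<close>, then bounds the number of nodes of the
  level.\<close>

lemma card_level_antichain:
  fixes \<kappa> :: "'a rel" and c :: "'c rel" and K :: "'c \<Rightarrow> 'a rel"
  assumes seq: "regular_sequence_with_sup c K \<kappa>"
    and pow: "\<And>\<mu> :: 'a rel. Card_order \<mu> \<Longrightarrow> \<mu> <o \<kappa> \<Longrightarrow> \<mu> ^c c <o \<kappa>"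
    and \<delta>: "\<delta> \<in> Field c"
  shows "|level_antichain c K \<delta>| \<le>o \<kappa>"
proof -
  have K: "Cinfinite (K \<alpha>)" "K \<alpha> <o \<kappa>" if "\<alpha> \<in> Field c" for \<alpha>
    using seq that unfolding regular_sequence_with_sup_def regular_cardinal_def by blast+
  have "|Field (K \<beta>)| \<le>o |Field (K \<delta>)|" if "\<beta> \<in> underS c \<delta>" for \<beta>
  proof -
    have "\<beta> \<in> Field c" using that underS_subset_Field[of c \<delta>] by blast
    moreover have "K \<beta> <o K \<delta>"
      using seq that \<delta> unfolding regular_sequence_with_sup_def by blast
    ultimately show ?thesis
      using card_of_mono2 ordLess_imp_ordLeq by blast
  qed
  moreover have "\<not> finite (Field (K \<delta>))"
    using K(1)[OF \<delta>] unfolding cinfinite_def by (rule conjunct1)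
  ultimately have "|nodes_at c K \<delta>| \<le>o K \<delta> ^c c"
    by (intro card_nodes_at)
  also have "K \<delta> ^c c \<le>o \<kappa>"
    using pow K[OF \<delta>] ordLess_imp_ordLeq by blast
  finally have nodes: "|nodes_at c K \<delta>| \<le>o \<kappa>" .
  have "|level_antichain c K \<delta>| \<le>o |trees_through c K ` nodes_at c K \<delta>|"
    unfolding level_antichain_def by (rule card_of_mono1) blast
  from this nodes show ?thesis
    by (rule ordLeq_transitive[OF _ ordLeq_transitive[OF card_of_image]])
qed

section \<open>Nodes of a tree below a join, and the contradiction\<close>

lemma nodes_below_join:
  assumes wo: "Well_order c" and \<delta>: "\<delta> \<in> Field c"
    and Y: "Y \<subseteq> level_antichain c K \<delta>"
    and T: "perfect_tree c K T"
    and below: "{S. perfect_tree c K S \<and> S \<subseteq> T} \<subseteq> ro_join (perfect_topology c K) Y"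
    and s: "s \<in> T" "s \<in> nodes_at c K \<delta>"
  shows "trees_through c K s \<in> Y"
proof -
  have "subtree_at T s \<in> ro_join (perfect_topology c K) Y"
    using below perfect_subtree_at[OF wo T s(1)] unfolding subtree_at_def by blast
  \<comment> \<open>Membership in the join gives, below \<open>subtree_at T s\<close>, a perfect
    tree \<open>S\<close> in some element of \<open>Y\<close>. As \<open>S\<close> also lies in
    \<open>trees_through c K s\<close>, that element can only be this set.\<close>
  then have "subtree_at T s \<in> perfect_topology c K closure_of \<Union>Y"
    unfolding ro_join_def by (rule subsetD[OF interior_of_subset])
  then obtain S where S: "perfect_tree c K S" "S \<subseteq> subtree_at T s" "S \<in> \<Union>Y"
    unfolding in_closure_of_perfect_topology by blast
  then obtain U where U: "U \<in> Y" "S \<in> U" by blast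
  obtain r where r: "r \<in> nodes_at c K \<delta>" "U = trees_through c K r"
    using U Y unfolding level_antichain_def by blast
  have "S \<in> trees_through c K s"
    using S unfolding trees_through_def subtree_at_def by blast
  then have "r = s" using trees_through_inj[OF wo \<delta> r(1) s(2)] U(2) r(2) by blast
  then show ?thesis using r U by simp
qed

text \<open>The domain of \<open>t\<close> determines the ordinal at which a new value is added, so
  all successors share one domain. Thus a single antichain handles all of them.\<close>

lemma Succ_in_same_level:
  assumes wo: "Well_order c" and T: "perfect_tree c K T" and ne: "Succ_in c T t \<noteq> {}"
  obtains \<delta> where "\<delta> \<in> Field c" "Succ_in c T t \<subseteq> nodes_at c K \<delta>"
proof -
  obtain s where s: "s \<in> Succ_in c T t" using ne by blast
  have sub: "Succ_in c T t \<subseteq> nodes c K"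
    using perfect_tree_nodes[OF T] unfolding Succ_in_def by blast
  \<comment> \<open>As \<open>s\<close> is a node, its domain is again given by an element \<delta>
    of \<open>Field c\<close>; this is the successor of the ordinal \<gamma> given by the domain of
    \<open>t\<close>.\<close>
  then obtain \<delta> where \<delta>: "\<delta> \<in> Field c" "dom s = underS c \<delta>" using s unfolding nodes_def by blast
  obtain \<gamma> x where \<gamma>: "\<gamma> \<in> Field c" "dom t = underS c \<gamma>" "s = t(\<gamma> \<mapsto> x)"
    using s unfolding Succ_in_def by blast
  have "dom u = underS c \<delta>" if u: "u \<in> Succ_in c T t" for u
  proof -
    obtain \<beta> y where \<beta>: "\<beta> \<in> Field c" "dom t = underS c \<beta>" "u = t(\<beta> \<mapsto> y)"
      using u unfolding Succ_in_def by blast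
    then have "\<beta> = \<gamma>" using underS_inj[OF wo] \<gamma> by metis
    then have "dom u = dom s" using \<beta>(3) \<gamma>(3) by simp
    then show ?thesis using \<delta>(2) by simp
  qed
  then have "Succ_in c T t \<subseteq> nodes_at c K \<delta>" using sub unfolding nodes_at_def by blast
  then show thesis using \<delta>(1) by (rule that[rotated])
qed

theorem theorem4p1:
  fixes \<kappa> :: "'a rel" and c :: "'c rel" and K :: "'c \<Rightarrow> 'a rel" and \<nu> :: "'n rel"
  assumes "singular_cardinal \<kappa>"
    and "is_cofinality c \<kappa>"
    and "regular_sequence_with_sup c K \<kappa>"
    and "\<And>\<mu> :: 'a rel. Card_order \<mu> \<Longrightarrow> \<mu> <o \<kappa> \<Longrightarrow> \<mu> ^c c <o \<kappa>"
    and "Card_order \<nu>" and "\<nu> <o \<kappa>"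
  shows "\<not> distributive_law {T. perfect_tree c K T} (\<subseteq>) c \<kappa> \<nu>"
proof
  let ?X = "perfect_topology c K"
  assume law: "distributive_law {T. perfect_tree c K T} (\<subseteq>) c \<kappa> \<nu>"
  have wo: "Well_order c"
    using assms(2) unfolding is_cofinality_def card_order_on_def by blast
  have "\<forall>\<delta>\<in>Field c. ro_maximal_antichain ?X (level_antichain c K \<delta>) \<and>
      |level_antichain c K \<delta>| \<le>o \<kappa>"
    using level_antichain_maximal[OF wo] card_level_antichain[OF assms(3,4)] by blast
  from law[unfolded distributive_law_def ro_distributive_def, THEN spec, THEN mp, OF this]
  obtain Y where Y0: "\<forall>\<delta>\<in>Field c. Y \<delta> \<subseteq> level_antichain c K \<delta> \<and> |Y \<delta>| \<le>o \<nu>"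
    and b0: "\<exists>b\<in>regular_opens ?X - {{}}. \<forall>\<delta>\<in>Field c. b \<subseteq> ro_join ?X (Y \<delta>)"
    by (elim exE conjE)
  from b0 obtain b where b: "b \<in> regular_opens ?X" "b \<noteq> {}"
      "\<And>\<delta>. \<delta> \<in> Field c \<Longrightarrow> b \<subseteq> ro_join ?X (Y \<delta>)"
    by blast
  from Y0 have Y: "\<And>\<delta>. \<delta> \<in> Field c \<Longrightarrow> Y \<delta> \<subseteq> level_antichain c K \<delta>"
      "\<And>\<delta>. \<delta> \<in> Field c \<Longrightarrow> |Y \<delta>| \<le>o \<nu>"
    by blast+
  obtain T where T: "T \<in> b" using b(2) by blast
  have perf: "perfect_tree c K T" using regular_open_perfect[OF b(1) T] .
  obtain \<alpha> where \<alpha>: "\<alpha> \<in> Field c" "\<nu> <o K \<alpha>"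
    using regular_sequence_with_sup_above[OF assms(3,5,6)] by blast
  obtain t where t: "K \<alpha> \<le>o |Succ_in c T t|"
    using perf \<alpha>(1) perfect_tree_nonempty[OF perf] unfolding perfect_tree_def by blast
  have big: "\<nu> <o |Succ_in c T t|" using ordLess_ordLeq_trans[OF \<alpha>(2) t] .
  have "Succ_in c T t \<noteq> {}"
    using not_ordLess_ordLeq[OF big] card_of_empty1[of \<nu>] assms(5)
    by metis
  then obtain \<delta> where \<delta>: "\<delta> \<in> Field c" "Succ_in c T t \<subseteq> nodes_at c K \<delta>"
    using Succ_in_same_level[OF wo perf] by blast
  \<comment> \<open>As a regular open set, \<open>b\<close> is downward closed, so it contains every
    perfect tree below \<open>T\<close>.\<close>
  have "{S. perfect_tree c K S \<and> S \<subseteq> T} \<subseteq> ro_join ?X (Y \<delta>)"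
    using regular_open_down[OF b(1) T] b(3)[OF \<delta>(1)] by blast
  then have "trees_through c K s \<in> Y \<delta>" if "s \<in> Succ_in c T t" for s
    using nodes_below_join[OF wo \<delta>(1) Y(1)[OF \<delta>(1)] perf] \<delta>(2) that
    unfolding Succ_in_def by blast
  \<comment> \<open>Disjointness gives injectivity only where the sets are nonempty;
    \<open>subtree_at T s\<close> is the required element.\<close>
  moreover have "inj_on (trees_through c K) (Succ_in c T t)"
  proof (rule inj_onI)
    fix s s' assume s: "s \<in> Succ_in c T t" "s' \<in> Succ_in c T t"
      and eq: "trees_through c K s = trees_through c K s'"
    have "subtree_at T s \<in> trees_through c K s"
      using subtree_at_in_trees_through[OF wo perf] s(1) unfolding Succ_in_def by blast
    then show "s = s'" using trees_through_inj[OF wo \<delta>(1)] s \<delta>(2) eq by blast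
  qed
  ultimately have "|Succ_in c T t| \<le>o |Y \<delta>|" by (intro card_of_ordLeqI)
  then show False
    using not_ordLess_ordLeq[OF big] ordLeq_transitive[OF _ Y(2)[OF \<delta>(1)]] by blast
qed

end
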